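(* Let $s\ge 1$ and $1\le k\le s$ be integers, let $\alpha\in(0,1)$, and let $$\alpha_i=\begin{cases}\dfrac{k\alpha}{s}, & i\le k,\\[2mm] \dfrac{k\alpha}{s+k-i}, & i>k,\end{cases}\qquad i=1,\ldots,s.$$ (i) For any $i$ with $k\le i\le s$ there exists a joint distribution for $\hat p_1,\ldots,\hat p_s$ such that $s+k-i$ of the variables $\hat p_1,\ldots,\hat p_s$ are (marginally) uniformly distributed on $(0,1)$ and $$P\{\hat p_{(1)}\le\alpha_1,\ \hat p_{(2)}\le\alpha_2,\ \ldots,\ \hat p_{(i-1)}\le\alpha_{i-1},\ \hat p_{(i)}\le\alpha_i\}=\alpha ,$$ where $\hat p_{(1)}\le\cdots\le\hat p_{(s)}$ are the ordered values. (ii) For testing $H_i:P\in\omega_i$, $i=1,\ldots,s$, with p-values satisfying $$P\{\hat p_i\le u\}\le u\quad\text{for any } u\in(0,1)\text{ and any } P\in\omega_i ,$$ one cannot increase even one of the constants $\alpha_i$ with $i\ge k$ in the stepdown procedure with constants $\alpha_1,\ldots,\alpha_s$ without violating control of the $k$-FWER. That is, if for some $i$ with $k\le i\le s$ the constant $\alpha_i$ is replaced by a larger constant and the other constants are left unchanged, then there exist a model $\Omega$, hypotheses $\omega_1,\ldots,\omega_s\subset\Omega$, p-values satisfying the displayed condition, and some $P\in\Omega$ for which the resulting stepdown procedure satisfies $$P\{\text{reject at least } k \text{ hypotheses } H_j \text{ with } j\in I(P)\}>\alpha .$$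
   Context: Data $X$ is available from some model $P\in\Omega$, where $\Omega$ is a family of probability distributions. A hypothesis $H_i$ is identified with a subset $\omega_i\subset\Omega$ and asserts $P\in\omega_i$. $I(P)=\{i: P\in\omega_i\}$ is the set of indices of true null hypotheses when $P$ is the true distribution. The p-values $\hat p_1,\ldots,\hat p_s$ are $[0,1]$-valued statistics (functions of $X$) with arbitrary joint dependence structure; the p-values of false hypotheses have arbitrary distribution. Let $\hat p_{(1)}\le\cdots\le\hat p_{(s)}$ be the ordered p-values and $H_{(1)},\ldots,H_{(s)}$ the associated hypotheses (ties ordered arbitrarily). The stepdown procedure with constants $\alpha_1,\ldots,\alpha_s$ is: if $\hat p_{(1)}>\alpha_1$, reject no hypotheses; otherwise reject $H_{(1)},\ldots,H_{(r)}$, where $r$ is the largest index such that $\hat p_{(1)}\le\alpha_1,\ldots,\hat p_{(r)}\le\alpha_r$. The procedure controls the $k$-FWER at level $\alpha$ if $P\{\text{reject at least } k \text{ hypotheses } H_i \text{ with } i\in I(P)\}\le\alpha$ for all $P\in\Omega$. *)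

theory Defs
  imports "HOL-Probability.Probability"
begin

(* p-values of s hypotheses, at one realisation of the data, are a function q on {1..s}. *)

definition ordered_value :: "nat \<Rightarrow> (nat \<Rightarrow> real) \<Rightarrow> nat \<Rightarrow> real" where
  "ordered_value s q m = sort (map q [1..<Suc s]) ! (m - 1)"

(* \<sigma> m is the index of the hypothesis H_(m); several \<sigma> are possible when there are ties. *)
definition hypothesis_ordering :: "nat \<Rightarrow> (nat \<Rightarrow> real) \<Rightarrow> (nat \<Rightarrow> nat) \<Rightarrow> bool" where
  "hypothesis_ordering s q \<sigma> \<longleftrightarrow>
     bij_betw \<sigma> {1..s} {1..s} \<and> mono_on {1..s} (\<lambda>m. q (\<sigma> m))"

(* r = 0 always satisfies the condition, so the value is 0 (no rejections) exactly when
   there are no hypotheses or the smallest p-value exceeds a 1.  No monotonicity of the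
   constants a is assumed. *)
definition num_rejected :: "nat \<Rightarrow> (nat \<Rightarrow> real) \<Rightarrow> (nat \<Rightarrow> real) \<Rightarrow> nat" where
  "num_rejected s a q = Max {r \<in> {0..s}. \<forall>m\<in>{1..r}. ordered_value s q m \<le> a m}"

definition stepdown_rejected ::
  "nat \<Rightarrow> (nat \<Rightarrow> real) \<Rightarrow> (nat \<Rightarrow> real) \<Rightarrow> (nat \<Rightarrow> nat) \<Rightarrow> nat set" where
  "stepdown_rejected s a q \<sigma> = \<sigma> ` {1..num_rejected s a q}"

definition stepdown_const :: "nat \<Rightarrow> nat \<Rightarrow> real \<Rightarrow> nat \<Rightarrow> real" where
  "stepdown_const s k \<alpha> i =
     (if i \<le> k then real k * \<alpha> / real s
      else real k * \<alpha> / (real s + real k - real i))"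

definition true_nulls :: "nat \<Rightarrow> (nat \<Rightarrow> 'x measure set) \<Rightarrow> 'x measure \<Rightarrow> nat set" where
  "true_nulls s \<omega> P = {i \<in> {1..s}. P \<in> \<omega> i}"

(* The data take values in the measurable space N (its measure is irrelevant); \<Omega> is a
   family of probability distributions on N. *)
definition testing_model ::
  "nat \<Rightarrow> 'x measure \<Rightarrow> 'x measure set \<Rightarrow> (nat \<Rightarrow> 'x measure set) \<Rightarrow> bool" where
  "testing_model s N \<Omega> \<omega> \<longleftrightarrow>
     (\<forall>P\<in>\<Omega>. prob_space P \<and> sets P = sets N) \<and> (\<forall>i\<in>{1..s}. \<omega> i \<subseteq> \<Omega>)"

definition p_values :: "nat \<Rightarrow> 'x measure \<Rightarrow> (nat \<Rightarrow> 'x \<Rightarrow> real) \<Rightarrow> bool" where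
  "p_values s N p \<longleftrightarrow>
     (\<forall>i\<in>{1..s}. p i \<in> borel_measurable N \<and> (\<forall>x\<in>space N. p i x \<in> {0..1}))"

definition valid_p_values ::
  "nat \<Rightarrow> (nat \<Rightarrow> 'x measure set) \<Rightarrow> (nat \<Rightarrow> 'x \<Rightarrow> real) \<Rightarrow> bool" where
  "valid_p_values s \<omega> p \<longleftrightarrow>
     (\<forall>i\<in>{1..s}. \<forall>P\<in>\<omega> i. \<forall>u\<in>{0<..<1}. measure P {x \<in> space P. p i x \<le> u} \<le> u)"

(* An arbitrary (data-dependent) way of ordering ties.  Measurability only ensures that
   the rejection events below have probabilities. *)
definition tie_ordering ::
  "nat \<Rightarrow> 'x measure \<Rightarrow> (nat \<Rightarrow> 'x \<Rightarrow> real) \<Rightarrow> ('x \<Rightarrow> nat \<Rightarrow> nat) \<Rightarrow> bool" where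
  "tie_ordering s N p \<sigma> \<longleftrightarrow>
     (\<forall>x\<in>space N. hypothesis_ordering s (\<lambda>i. p i x) (\<sigma> x)) \<and>
     (\<forall>m\<in>{1..s}. (\<lambda>x. \<sigma> x m) \<in> measurable N (count_space UNIV))"

definition kFWER ::
  "nat \<Rightarrow> nat \<Rightarrow> (nat \<Rightarrow> real) \<Rightarrow> (nat \<Rightarrow> 'x measure set) \<Rightarrow> (nat \<Rightarrow> 'x \<Rightarrow> real) \<Rightarrow>
   ('x \<Rightarrow> nat \<Rightarrow> nat) \<Rightarrow> 'x measure \<Rightarrow> real" where
  "kFWER s k a \<omega> p \<sigma> P =
     measure P {x \<in> space P.
       k \<le> card (stepdown_rejected s a (\<lambda>i. p i x) (\<sigma> x) \<inter> true_nulls s \<omega> P)}"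

end

theory Submission
  imports Defs
begin

text \<open>
  Fix \<open>i\<close> with \<open>k \<le> i \<le> s\<close> and put \<open>n = s + k - i\<close>, so that \<open>k \<le> n \<le> s\<close>. Both parts rest on one
  joint distribution, driven by a single uniform variable \<open>U\<close> on \<open>(0,1)\<close> and a level \<open>\<gamma>\<close>. Of
  the p-values, \<open>s - n = i - k\<close> are identically \<open>0\<close> (the false hypotheses). The other \<open>n\<close> equal
  \<open>U\<close> as long as \<open>U > \<gamma>\<close>, but on \<open>U \<le> \<gamma>\<close> the \<open>j\<close>-th of them is \<open>U\<close> rotated by \<open>j\<gamma>/n\<close>
  within \<open>(0,\<gamma>]\<close>. A rotation preserves Lebesgue measure, so each of the \<open>n\<close> is uniform
  (\<open>distr_rotate_upto\<close>). On \<open>U \<le> \<gamma>\<close> they are equally spaced on the circle, so each of the \<open>n\<close>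
  cells of length \<open>\<gamma>/n\<close> contains exactly one, and the \<open>l\<close>-th smallest of them is at most
  \<open>l\<gamma>/n\<close> (\<open>card_rotations_le\<close>). Once the \<open>i - k\<close> zeros are counted, the \<open>m\<close>-th smallest of all
  \<open>s\<close> p-values is at most \<open>(m + k - i)\<gamma>/n\<close>, the coefficient being truncated at \<open>0\<close>.

  For \<open>\<gamma> = \<alpha>\<close> this bound equals \<open>\<alpha>\<^sub>i\<close> at \<open>m = i\<close>, and it lies strictly below \<open>\<alpha>\<^sub>m\<close> for
  \<open>m < i\<close>: where it is positive, with \<open>l = m + k - i\<close>, it suffices that \<open>l(n + k - l) < kn\<close>,
  that is, \<open>(k - l)(n - l) > 0\<close> (\<open>stepdown_const_gt\<close>). Hence \<open>U \<le> \<alpha>\<close> implies the event in part (i). Conversely, on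
  \<open>U > \<alpha> \<ge> \<alpha>\<^sub>i\<close> only the \<open>i - k < i\<close> zeros are \<open>\<le> \<alpha>\<^sub>i\<close>, so the event has probability exactly
  \<open>\<alpha>\<close>.

  For part (ii) the decisive point is that the inequality is strict for every \<open>m < i\<close>. If \<open>\<alpha>\<^sub>i\<close> is
  replaced by a larger \<open>c\<close>, all the inequalities with \<open>m \<le> i\<close> become strict, and they survive
  when \<open>\<gamma>\<close> is chosen slightly larger than \<open>\<alpha>\<close>. With probability at least \<open>\<gamma> > \<alpha>\<close> the procedure
  then rejects at least \<open>i\<close> hypotheses, of which at most \<open>i - k\<close> are false.
\<close>

section \<open>Order statistics and the stepdown procedure\<close>

text \<open>
  This replaces order statistics by counts, which are easy both to bound and to measure.
\<close>

lemma ordered_value_le_iff: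
  assumes "m \<in> {1..s}"
  shows "ordered_value s q m \<le> t \<longleftrightarrow> m \<le> card {j \<in> {1..s}. q j \<le> t}"
proof -
  define xs where "xs = sort (map q [1..<Suc s])"
  have len: "length xs = s" by (simp add: xs_def)
  have sorted: "sorted xs" by (simp add: xs_def)
  let ?I = "{l. l < length xs \<and> xs ! l \<le> t}"
  have "card ?I = length (filter (\<lambda>x. x \<le> t) xs)"
    by (simp add: length_filter_conv_card)
  also have "\<dots> = length (filter (\<lambda>x. x \<le> t) (map q [1..<Suc s]))"
    unfolding xs_def by (metis mset_filter mset_sort size_mset)
  also have "\<dots> = length (filter (\<lambda>j. q j \<le> t) [1..<Suc s])"
    by (simp only: filter_map length_map o_def)
  also have "\<dots> = card (set (filter (\<lambda>j. q j \<le> t) [1..<Suc s]))"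
    by (intro distinct_card [symmetric] distinct_filter distinct_upt)
  also have "set (filter (\<lambda>j. q j \<le> t) [1..<Suc s]) = {j \<in> {1..s}. q j \<le> t}"
    by (simp add: atLeastLessThanSuc_atLeastAtMost del: upt_Suc)
  finally have card_I: "card ?I = card {j \<in> {1..s}. q j \<le> t}" .
  have "xs ! (m - 1) \<le> t \<longleftrightarrow> m \<le> card ?I"
  proof
    assume le: "xs ! (m - 1) \<le> t"
    have "{..<m} \<subseteq> ?I"
    proof
      fix l assume "l \<in> {..<m}"
      moreover from this have "xs ! l \<le> xs ! (m - 1)"
        using assms len by (intro sorted_nth_mono sorted) auto
      ultimately show "l \<in> ?I" using le assms len by auto
    qed
    from card_mono [OF _ this] show "m \<le> card ?I" by simp
  next
    assume le: "m \<le> card ?I"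
    show "xs ! (m - 1) \<le> t"
    proof (rule ccontr)
      assume gt: "\<not> xs ! (m - 1) \<le> t"
      have "?I \<subseteq> {..<m - 1}"
      proof
        fix l assume l: "l \<in> ?I"
        have "l < m - 1"
        proof (rule ccontr)
          assume "\<not> l < m - 1"
          then have "xs ! (m - 1) \<le> xs ! l"
            using l by (intro sorted_nth_mono sorted) auto
          with l gt show False by auto
        qed
        then show "l \<in> {..<m - 1}" by simp
      qed
      from card_mono [OF _ this] have "card ?I \<le> m - 1" by simp
      with le assms show False by auto
    qed
  qed
  then show ?thesis by (simp only: card_I ordered_value_def flip: xs_def)
qed

lemma num_rejected_mem:
  "num_rejected s a q \<in> {r \<in> {0..s}. \<forall>l\<in>{1..r}. ordered_value s q l \<le> a l}"
  (is "_ \<in> ?R")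
proof -
  have "0 \<in> ?R" by simp
  then have "?R \<noteq> {}" by blast
  moreover have "finite ?R" by simp
  ultimately show ?thesis unfolding num_rejected_def by (intro Max_in)
qed

lemma num_rejected_le: "num_rejected s a q \<le> s"
  using num_rejected_mem [of s a q] by (simp only: mem_Collect_eq atLeastAtMost_iff)

lemma le_num_rejected_iff:
  assumes "m \<le> s"
  shows "m \<le> num_rejected s a q \<longleftrightarrow> (\<forall>l\<in>{1..m}. ordered_value s q l \<le> a l)"
proof
  have "\<forall>l\<in>{1..num_rejected s a q}. ordered_value s q l \<le> a l"
    using num_rejected_mem [of s a q] by blast
  then show "\<forall>l\<in>{1..m}. ordered_value s q l \<le> a l" if "m \<le> num_rejected s a q"
    using that by (meson atLeastAtMost_iff le_trans)
  show "m \<le> num_rejected s a q" if "\<forall>l\<in>{1..m}. ordered_value s q l \<le> a l"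
    unfolding num_rejected_def using that assms by (intro Max_ge) auto
qed

text \<open>
  The left side involves the data-dependent set of rejected hypotheses. On the right the index
  set is fixed and the data enter only through events of each rank, which makes the number of
  false rejections visibly measurable.
\<close>

lemma card_stepdown_rejected_Int:
  assumes "hypothesis_ordering s q \<sigma>"
  shows "card (stepdown_rejected s a q \<sigma> \<inter> J) =
    card {m \<in> {1..s}. (\<forall>l\<in>{1..m}. ordered_value s q l \<le> a l) \<and> \<sigma> m \<in> J}"
proof -
  let ?M = "{m \<in> {1..s}. (\<forall>l\<in>{1..m}. ordered_value s q l \<le> a l) \<and> \<sigma> m \<in> J}"
  have "m \<in> ?M \<longleftrightarrow> m \<in> {1..num_rejected s a q} \<and> \<sigma> m \<in> J" for m
    using le_num_rejected_iff [of m s a q] num_rejected_le [of s a q] by auto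
  then have M: "?M = {m \<in> {1..num_rejected s a q}. \<sigma> m \<in> J}" by blast
  have "inj_on \<sigma> {1..s}"
    using assms by (simp add: hypothesis_ordering_def bij_betw_def)
  then have "inj_on \<sigma> ?M" by (rule inj_on_subset) auto
  moreover have "stepdown_rejected s a q \<sigma> \<inter> J = \<sigma> ` ?M"
    unfolding M stepdown_rejected_def by auto
  ultimately show ?thesis by (simp only: card_image)
qed

text \<open>
  At least \<open>i\<close> hypotheses are rejected, and only \<open>s - card J = i - k\<close> lie outside \<open>J\<close>.
\<close>

lemma stepdown_rejects_true_nulls:
  assumes \<sigma>: "hypothesis_ordering s q \<sigma>" and "i \<le> s"
    and J: "J \<subseteq> {1..s}" "card J + i = s + k"
    and le: "\<forall>m\<in>{1..i}. ordered_value s q m \<le> a m"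
  shows "k \<le> card (stepdown_rejected s a q \<sigma> \<inter> J)"
proof -
  let ?R = "stepdown_rejected s a q \<sigma>"
  have bij: "bij_betw \<sigma> {1..s} {1..s}"
    using \<sigma> by (simp add: hypothesis_ordering_def)
  have sub: "{1..num_rejected s a q} \<subseteq> {1..s}"
    using num_rejected_le [of s a q] by auto
  have "inj_on \<sigma> {1..num_rejected s a q}"
    using bij sub by (auto simp: bij_betw_def intro: inj_on_subset)
  then have "card ?R = num_rejected s a q"
    by (simp add: stepdown_rejected_def card_image)
  moreover have "i \<le> num_rejected s a q"
    using le \<open>i \<le> s\<close> by (simp add: le_num_rejected_iff)
  moreover have R: "?R \<subseteq> {1..s}"
    unfolding stepdown_rejected_def using bij sub by (auto simp: bij_betw_def)
  have "finite ?R" "finite J" using R J(1) by (auto intro: finite_subset)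
  then have "card ?R + card J = card (?R \<union> J) + card (?R \<inter> J)"
    by (rule card_Un_Int)
  moreover have "card (?R \<union> J) \<le> card {1..s}"
    using R J(1) by (intro card_mono) auto
  ultimately show ?thesis using J(2) by simp
qed

section \<open>Measurability\<close>

lemma measurable_le_card:
  assumes "finite A" and "\<And>m. m \<in> A \<Longrightarrow> Measurable.pred M (P m)"
  shows "Measurable.pred M (\<lambda>x. (k::nat) \<le> card {m \<in> A. P m x})"
proof -
  have "card {m \<in> A. P m x} = (\<Sum>m\<in>A. if P m x then 1 else 0)" for x
    using assms(1) by (simp add: sum.If_cases Int_def)
  moreover have "(\<lambda>x. \<Sum>m\<in>A. if P m x then 1 else (0::nat)) \<in> measurable M (count_space UNIV)"
    using assms(2) by measurable
  ultimately show ?thesis by simp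
qed

abbreviation unit_cube :: "nat \<Rightarrow> (nat \<Rightarrow> real) measure" where
  "unit_cube s \<equiv> Pi\<^sub>M {1..s} (\<lambda>_. restrict_space borel {0..1})"

lemma measurable_coordinate:
  assumes "j \<in> {1..s}"
  shows "(\<lambda>q. q j) \<in> borel_measurable (unit_cube s)"
  using measurable_compose [OF measurable_component_singleton [OF assms]
      measurable_restrict_space1 [OF measurable_ident]] by simp

lemma measurable_ordered_value_le:
  assumes "m \<in> {1..s}"
  shows "Measurable.pred (unit_cube s) (\<lambda>q. ordered_value s q m \<le> t)"
proof -
  have "Measurable.pred (unit_cube s) (\<lambda>q. q j \<le> t)" if "j \<in> {1..s}" for j
    using measurable_coordinate [OF that] by measurable
  then show ?thesis
    unfolding ordered_value_le_iff [OF assms] by (intro measurable_le_card) auto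
qed

lemma measurable_ordered_values_le:
  assumes "i \<le> s"
  shows "Measurable.pred (unit_cube s) (\<lambda>q. \<forall>m\<in>{1..i}. ordered_value s q m \<le> a m)"
  using assms by (intro pred_intros_finite measurable_ordered_value_le) auto

text \<open>
  Monotonicity of a measure only helps if the larger set is measurable, so the lower bound on
  the error probability needs this for every admissible way of breaking ties.
\<close>

lemma measurable_rejects_at_least:
  assumes \<sigma>: "tie_ordering s (unit_cube s) (\<lambda>i q. q i) \<sigma>"
  shows "Measurable.pred (unit_cube s) (\<lambda>q. k \<le> card (stepdown_rejected s a q (\<sigma> q) \<inter> J))"
proof -
  have "Measurable.pred (unit_cube s)
      (\<lambda>q. (\<forall>l\<in>{1..m}. ordered_value s q l \<le> a l) \<and> \<sigma> q m \<in> J)" if m: "m \<in> {1..s}" for m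
  proof (intro pred_intros_logic measurable_ordered_values_le)
    have "(\<lambda>q. \<sigma> q m) \<in> measurable (unit_cube s) (count_space UNIV)"
      using \<sigma> m by (simp add: tie_ordering_def)
    then show "Measurable.pred (unit_cube s) (\<lambda>q. \<sigma> q m \<in> J)" by measurable
  qed (use m in auto)
  then have "Measurable.pred (unit_cube s) (\<lambda>q. k \<le> card {m \<in> {1..s}.
      (\<forall>l\<in>{1..m}. ordered_value s q l \<le> a l) \<and> \<sigma> q m \<in> J})"
    by (intro measurable_le_card) auto
  also have "?this \<longleftrightarrow> ?thesis"
    using \<sigma> by (intro measurable_cong) (simp add: tie_ordering_def card_stepdown_rejected_Int)
  finally show ?thesis .
qed

section \<open>Rotations of an initial interval\<close>

text \<open>
  For \<open>0 \<le> t \<le> \<gamma>\<close> this is rotation by \<open>t\<close> on the circle \<open>(0,\<gamma>]\<close> and the identity beyond. The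
  interval is closed on the right so that the cells \<open>(h\<gamma>/n, (h+1)\<gamma>/n]\<close> fit the weak
  inequalities by which the procedure rejects.
\<close>

definition rotate_upto :: "real \<Rightarrow> real \<Rightarrow> real \<Rightarrow> real" where
  "rotate_upto \<gamma> t u = (if u \<le> \<gamma> then if u + t \<le> \<gamma> then u + t else u + t - \<gamma> else u)"

abbreviation unit_lebesgue :: "real measure" where
  "unit_lebesgue \<equiv> restrict_space lborel {0<..<1}"

lemma space_unit_lebesgue: "space unit_lebesgue = {0<..<1}"
  by (simp add: space_restrict_space)

lemma emeasure_unit_lebesgue:
  "A \<in> sets borel \<Longrightarrow> emeasure unit_lebesgue ({0<..<1} \<inter> A) = emeasure lborel ({0<..<1} \<inter> A)"
  by (subst emeasure_restrict_space) (auto simp: sets_restrict_space)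

lemma prob_space_unit_lebesgue: "prob_space unit_lebesgue"
  by (rule prob_spaceI) (use emeasure_unit_lebesgue [of UNIV] in \<open>simp add: space_unit_lebesgue\<close>)

lemma measurable_rotate_upto: "rotate_upto \<gamma> t \<in> borel_measurable borel"
  unfolding rotate_upto_def by measurable

lemma measurable_unit_lebesgue:
  "f \<in> borel_measurable borel \<Longrightarrow> f \<in> borel_measurable unit_lebesgue"
  by (rule measurable_restrict_space1) simp

lemma emeasure_lborel_vimage_plus:
  assumes "A \<in> sets borel"
  shows "emeasure lborel ((\<lambda>x. x + c) -` A) = emeasure lborel (A :: real set)"
proof -
  have "emeasure lborel A = emeasure (distr lborel borel (\<lambda>x. c + x)) A"
    by (simp add: lborel_distr_plus)
  also have "\<dots> = emeasure lborel ((\<lambda>x. x + c) -` A)"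
    using assms by (simp add: emeasure_distr add.commute)
  finally show ?thesis by simp
qed

text \<open>
  The preimage of a set consists of three disjoint pieces, each a translate of the part of that
  set in \<open>(t,\<gamma>]\<close>, in \<open>(0,t]\<close> or in \<open>(\<gamma>,1)\<close>.
\<close>

lemma distr_rotate_upto:
  assumes "0 \<le> t" "t \<le> \<gamma>" "\<gamma> < 1"
  shows "distr unit_lebesgue borel (rotate_upto \<gamma> t) = uniform_measure lborel {0<..<1}"
proof (rule measure_eqI)
  fix A :: "real set"
  assume "A \<in> sets (distr unit_lebesgue borel (rotate_upto \<gamma> t))"
  then have A [measurable]: "A \<in> sets borel" by simp
  note measurable_rotate_upto [measurable]
  let ?S1 = "(\<lambda>x. x + t) -` (A \<inter> {t<..\<gamma>})"
  let ?S2 = "(\<lambda>x. x + (t - \<gamma>)) -` (A \<inter> {0<..t})"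
  let ?S3 = "A \<inter> {\<gamma><..<1}"
  have vimage: "{0<..<1} \<inter> rotate_upto \<gamma> t -` A = ?S1 \<union> ?S2 \<union> ?S3"
    using assms by (auto simp: rotate_upto_def algebra_simps split: if_splits)
  have parts: "{0<..<1} \<inter> A = (A \<inter> {t<..\<gamma>}) \<union> (A \<inter> {0<..t}) \<union> ?S3"
    using assms by auto
  have S: "?S1 \<in> sets borel" "?S2 \<in> sets borel"
    by (rule measurable_sets_borel; measurable)+
  have "emeasure (distr unit_lebesgue borel (rotate_upto \<gamma> t)) A
      = emeasure unit_lebesgue ({0<..<1} \<inter> rotate_upto \<gamma> t -` A)"
    by (subst emeasure_distr)
      (auto simp: space_unit_lebesgue Int_commute intro: measurable_unit_lebesgue)
  also have "\<dots> = emeasure lborel ({0<..<1} \<inter> rotate_upto \<gamma> t -` A)"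
    by (rule emeasure_unit_lebesgue) (rule measurable_sets_borel [OF _ A], measurable)
  also have "\<dots> = emeasure lborel ?S1 + emeasure lborel ?S2 + emeasure lborel ?S3"
    unfolding vimage using S assms by (subst plus_emeasure [symmetric], simp, simp, force)+ simp
  also have "\<dots> = emeasure lborel (A \<inter> {t<..\<gamma>}) + emeasure lborel (A \<inter> {0<..t})
      + emeasure lborel ?S3"
    by (simp add: emeasure_lborel_vimage_plus del: vimage_Int)
  also have "\<dots> = emeasure lborel ({0<..<1} \<inter> A)"
    unfolding parts using assms by (subst plus_emeasure [symmetric], simp, simp, force)+ simp
  also have "\<dots> = emeasure (uniform_measure lborel {0<..<1}) A"
    by (simp add: divide_ennreal_def)
  finally show "emeasure (distr unit_lebesgue borel (rotate_upto \<gamma> t)) A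
      = emeasure (uniform_measure lborel {0<..<1}) A" .
qed simp

text \<open>
  If \<open>u\<close> lies in the \<open>c\<close>-th cell \<open>(c\<gamma>/n, (c+1)\<gamma>/n]\<close>, the rotation by \<open>h - c\<close> cells, taken
  modulo \<open>n\<close>, moves it to the \<open>h\<close>-th one. The cells \<open>h < l\<close> therefore contribute \<open>l\<close> different
  rotations with values at most \<open>l\<gamma>/n\<close>.
\<close>

lemma card_rotations_le:
  assumes "0 < n" "l \<le> n" "0 < u" "u \<le> \<gamma>"
  shows "l \<le> card {j \<in> {1..n}. rotate_upto \<gamma> (real j * \<gamma> / real n) u \<le> real l * \<gamma> / real n}"
proof -
  define d where "d = \<gamma> / real n"
  have d: "0 < d" and nd: "real n * d = \<gamma>" using assms by (auto simp: d_def)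
  define c where "c = nat (\<lceil>u / d\<rceil> - 1)"
  have "0 < u / d" using assms d by simp
  then have "real c < u / d" "u / d \<le> real c + 1"
    unfolding c_def by linarith+
  then have c: "real c * d < u" "u \<le> (real c + 1) * d"
    using d by (simp_all add: field_simps)
  have "real c * d < real n * d" using c(1) assms(4) nd by linarith
  then have "c < n" using d by simp
  \<comment> \<open>The representative of \<open>h - c\<close> modulo \<open>n\<close> in \<open>{1..n}\<close>: the rotation by \<open>n\<close> cells stands for
    the identity.\<close>
  define f where "f h = (if c < h then h - c else n + h - c)" for h
  have "inj_on f {..<l}"
    using \<open>l \<le> n\<close> \<open>c < n\<close> by (intro inj_onI) (auto simp: f_def split: if_splits)
  then have card: "card (f ` {..<l}) = l" by (simp add: card_image)
  have "f ` {..<l} \<subseteq> {j \<in> {1..n}. rotate_upto \<gamma> (real j * \<gamma> / real n) u \<le> real l * \<gamma> / real n}"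
  proof safe
    fix h assume h: "h < l"
    show "f h \<in> {1..n}"
      using h \<open>l \<le> n\<close> \<open>c < n\<close> by (auto simp: f_def)
    have "(real h + 1) * d \<le> real l * d"
      using h d by (intro mult_right_mono) auto
    then have hd_le: "real h * d + d \<le> real l * d" by (simp add: algebra_simps)
    have ld_le: "real l * d \<le> real n * d"
      using \<open>l \<le> n\<close> d by (intro mult_right_mono) auto
    have hd_ge: "0 \<le> real h * d" using d by simp
    have u_le: "u \<le> real c * d + d" using c(2) by (simp add: algebra_simps)
    have "rotate_upto \<gamma> (real (f h) * d) u \<le> real l * d"
    proof (cases "c < h")
      case True
      then have "real (f h) * d = real h * d - real c * d"
        by (simp add: f_def algebra_simps)
      then have "u + real (f h) * d \<le> real l * d"
        using hd_le u_le by linarith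
      then show ?thesis
        using ld_le nd \<open>u \<le> \<gamma>\<close> by (simp add: rotate_upto_def)
    next
      case False
      then have "real (f h) * d = real h * d - real c * d + \<gamma>"
        using \<open>c < n\<close> nd by (simp add: f_def algebra_simps)
      then have "\<gamma> < u + real (f h) * d" "u + real (f h) * d - \<gamma> \<le> real l * d"
        using hd_le hd_ge u_le c(1) by linarith+
      then show ?thesis
        using \<open>u \<le> \<gamma>\<close> by (simp add: rotate_upto_def)
    qed
    then show "rotate_upto \<gamma> (real (f h) * \<gamma> / real n) u \<le> real l * \<gamma> / real n"
      by (simp add: d_def)
  qed
  from card_mono [OF _ this] card show ?thesis by simp
qed

section \<open>The least favourable joint distribution\<close>

definition least_favourable_pvalues :: "nat \<Rightarrow> nat \<Rightarrow> real \<Rightarrow> real \<Rightarrow> nat \<Rightarrow> real" where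
  "least_favourable_pvalues s n \<gamma> u =
     (\<lambda>j\<in>{1..s}. if j \<le> n then rotate_upto \<gamma> (real j * \<gamma> / real n) u else 0)"

definition least_favourable :: "nat \<Rightarrow> nat \<Rightarrow> real \<Rightarrow> (nat \<Rightarrow> real) measure" where
  "least_favourable s n \<gamma> = distr unit_lebesgue (unit_cube s) (least_favourable_pvalues s n \<gamma>)"

lemma rotate_upto_range:
  assumes "0 \<le> t" "t \<le> \<gamma>" "\<gamma> < 1" "u \<in> {0<..<1}"
  shows "rotate_upto \<gamma> t u \<in> {0..1}"
  using assms by (auto simp: rotate_upto_def)

lemma shift_range:
  assumes "j \<in> {1..n}" "0 < (\<gamma>::real)"
  shows "0 \<le> real j * \<gamma> / real n" "real j * \<gamma> / real n \<le> \<gamma>"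
  using assms by (auto simp: divide_le_eq mult.commute)

lemma measurable_least_favourable_pvalues:
  assumes "0 < \<gamma>" "\<gamma> < 1"
  shows "least_favourable_pvalues s n \<gamma> \<in> measurable unit_lebesgue (unit_cube s)"
  unfolding least_favourable_pvalues_def
proof (rule measurable_restrict)
  fix j assume j: "j \<in> {1..s}"
  have "(if j \<le> n then rotate_upto \<gamma> (real j * \<gamma> / real n) u else 0) \<in> {0..1}"
    if "u \<in> {0<..<1}" for u
    using rotate_upto_range [OF shift_range [of j n \<gamma>] _ that] assms j by auto
  moreover have "(\<lambda>u. if j \<le> n then rotate_upto \<gamma> (real j * \<gamma> / real n) u else 0)
      \<in> borel_measurable unit_lebesgue"
    by (cases "j \<le> n") (auto intro: measurable_unit_lebesgue measurable_rotate_upto)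
  ultimately show "(\<lambda>u. if j \<le> n then rotate_upto \<gamma> (real j * \<gamma> / real n) u else 0)
      \<in> measurable unit_lebesgue (restrict_space borel {0..1})"
    by (intro measurable_restrict_space2) (auto simp: space_unit_lebesgue)
qed

lemma prob_space_least_favourable:
  assumes "0 < \<gamma>" "\<gamma> < 1"
  shows "prob_space (least_favourable s n \<gamma>)"
  unfolding least_favourable_def
  by (intro prob_space.prob_space_distr prob_space_unit_lebesgue
      measurable_least_favourable_pvalues assms)

lemma sets_least_favourable [measurable_cong]:
  "sets (least_favourable s n \<gamma>) = sets (unit_cube s)"
  by (simp add: least_favourable_def)

lemma least_favourable_marginal:
  assumes "0 < \<gamma>" "\<gamma> < 1" "n \<le> s" "j \<in> {1..n}"
  shows "distr (least_favourable s n \<gamma>) borel (\<lambda>q. q j) = uniform_measure lborel {0<..<1}"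
proof -
  have j: "j \<in> {1..s}" using assms by auto
  have "distr (least_favourable s n \<gamma>) borel (\<lambda>q. q j)
      = distr unit_lebesgue borel ((\<lambda>q. q j) \<circ> least_favourable_pvalues s n \<gamma>)"
    unfolding least_favourable_def
    by (intro distr_distr measurable_coordinate [OF j] measurable_least_favourable_pvalues assms)
  also have "(\<lambda>q. q j) \<circ> least_favourable_pvalues s n \<gamma> = rotate_upto \<gamma> (real j * \<gamma> / real n)"
    using j assms by (auto simp: least_favourable_pvalues_def fun_eq_iff)
  also have "distr unit_lebesgue borel \<dots> = uniform_measure lborel {0<..<1}"
    using assms by (intro distr_rotate_upto shift_range)
  finally show ?thesis .
qed

lemma measure_least_favourable:
  assumes "0 < \<gamma>" "\<gamma> < 1" "Measurable.pred (unit_cube s) \<Phi>"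
  shows "measure (least_favourable s n \<gamma>) {q \<in> space (least_favourable s n \<gamma>). \<Phi> q}
    = measure unit_lebesgue {u \<in> {0<..<1}. \<Phi> (least_favourable_pvalues s n \<gamma> u)}"
proof -
  note meas = measurable_least_favourable_pvalues [OF assms(1,2), of s n]
  have "{q \<in> space (unit_cube s). \<Phi> q} \<in> sets (unit_cube s)"
    using assms(3) by (rule predE)
  then have "measure (least_favourable s n \<gamma>) {q \<in> space (unit_cube s). \<Phi> q}
    = measure unit_lebesgue
        (least_favourable_pvalues s n \<gamma> -` {q \<in> space (unit_cube s). \<Phi> q} \<inter> space unit_lebesgue)"
    unfolding least_favourable_def by (rule measure_distr [OF meas])
  also have "least_favourable_pvalues s n \<gamma> -` {q \<in> space (unit_cube s). \<Phi> q} \<inter> space unit_lebesgue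
      = {u \<in> {0<..<1}. \<Phi> (least_favourable_pvalues s n \<gamma> u)}"
    using measurable_space [OF meas] unfolding space_unit_lebesgue by blast
  finally show ?thesis by (simp only: least_favourable_def space_distr)
qed

lemma measure_unit_lebesgue_le:
  assumes "0 < \<gamma>" "\<gamma> < 1"
  shows "measure unit_lebesgue {u \<in> {0<..<1}. u \<le> \<gamma>} = \<gamma>"
proof -
  have "emeasure unit_lebesgue ({0<..<1} \<inter> {..\<gamma>}) = emeasure lborel ({0<..<1} \<inter> {..\<gamma>})"
    by (rule emeasure_unit_lebesgue) simp
  also have "{0<..<1} \<inter> {..\<gamma>} = {0<..\<gamma>}" using assms by auto
  also have "emeasure lborel {0<..\<gamma>} = ennreal \<gamma>" using assms by simp
  also have "{0<..\<gamma>} = {u \<in> {0<..<1}. u \<le> \<gamma>}" using assms by auto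
  finally show ?thesis using assms by (simp add: measure_def)
qed

text \<open>
  The \<open>s - n\<close> zeros account for the first ranks, where the truncated difference \<open>m + n - s\<close> is
  \<open>0\<close>; the later ranks are those of the rotated variables.
\<close>

lemma least_favourable_ordered_value_le:
  assumes "0 < n" "n \<le> s" "m \<in> {1..s}" "u \<in> {0<..\<gamma>}" "real (m + n - s) * \<gamma> / real n \<le> t"
  shows "ordered_value s (least_favourable_pvalues s n \<gamma> u) m \<le> t"
proof -
  let ?q = "least_favourable_pvalues s n \<gamma> u"
  let ?l = "m + n - s"
  let ?T = "{j \<in> {1..n}. rotate_upto \<gamma> (real j * \<gamma> / real n) u \<le> real ?l * \<gamma> / real n}"
  have "0 \<le> real ?l * \<gamma> / real n" using assms by auto
  then have "0 \<le> t" using assms(5) by linarith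
  then have sub: "?T \<union> {n<..s} \<subseteq> {j \<in> {1..s}. ?q j \<le> t}"
    using assms by (auto simp: least_favourable_pvalues_def)
  have "?l \<le> card ?T"
    using assms by (intro card_rotations_le) auto
  then have "m \<le> card ?T + card {n<..s}" using assms by simp
  also have "\<dots> = card (?T \<union> {n<..s})"
    by (rule card_Un_disjoint [symmetric]) auto
  also have "\<dots> \<le> card {j \<in> {1..s}. ?q j \<le> t}"
    by (rule card_mono [OF _ sub]) simp
  finally show ?thesis by (simp add: ordered_value_le_iff [OF assms(3)])
qed

lemma least_favourable_ordered_value_gt:
  assumes "n \<le> s" "m \<in> {1..s}" "s < m + n" "\<gamma> < u" "t \<le> \<gamma>"
  shows "\<not> ordered_value s (least_favourable_pvalues s n \<gamma> u) m \<le> t"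
proof -
  have "{j \<in> {1..s}. least_favourable_pvalues s n \<gamma> u j \<le> t} \<subseteq> {n<..s}"
    using assms by (auto simp: least_favourable_pvalues_def rotate_upto_def split: if_splits)
  from card_mono [OF _ this] show ?thesis
    using assms by (simp add: ordered_value_le_iff [OF assms(2)])
qed

lemma least_favourable_prob_ge:
  assumes "0 < \<gamma>" "\<gamma> < 1" "0 < n" "n \<le> s" "i \<le> s"
    and a: "\<And>m. m \<in> {1..i} \<Longrightarrow> real (m + n - s) * \<gamma> / real n \<le> a m"
  shows "\<gamma> \<le> measure (least_favourable s n \<gamma>)
    {q \<in> space (least_favourable s n \<gamma>). \<forall>m\<in>{1..i}. ordered_value s q m \<le> a m}"
proof -
  let ?q = "least_favourable_pvalues s n \<gamma>"
  let ?E = "{u \<in> {0<..<1}. \<forall>m\<in>{1..i}. ordered_value s (?q u) m \<le> a m}"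
  interpret prob_space unit_lebesgue by (rule prob_space_unit_lebesgue)
  have "Measurable.pred unit_lebesgue (\<lambda>u. \<forall>m\<in>{1..i}. ordered_value s (?q u) m \<le> a m)"
    by (rule measurable_compose [OF measurable_least_favourable_pvalues
          measurable_ordered_values_le]) (use assms in auto)
  then have "?E \<in> sets unit_lebesgue"
    by (auto dest!: predE simp: space_unit_lebesgue)
  moreover have "{u \<in> {0<..<1}. u \<le> \<gamma>} \<subseteq> ?E"
    using assms by (auto intro!: least_favourable_ordered_value_le)
  ultimately have "measure unit_lebesgue {u \<in> {0<..<1}. u \<le> \<gamma>} \<le> measure unit_lebesgue ?E"
    by (intro finite_measure_mono)
  then show ?thesis
    unfolding measure_unit_lebesgue_le [OF assms(1,2)]
      measure_least_favourable [OF assms(1,2) measurable_ordered_values_le [OF \<open>i \<le> s\<close>]] .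
qed

lemma least_favourable_prob_eq:
  assumes "0 < \<gamma>" "\<gamma> < 1" "0 < n" "n \<le> s" "i \<in> {1..s}" "s < i + n"
    and a: "\<And>m. m \<in> {1..i} \<Longrightarrow> real (m + n - s) * \<gamma> / real n \<le> a m" and "a i \<le> \<gamma>"
  shows "measure (least_favourable s n \<gamma>)
    {q \<in> space (least_favourable s n \<gamma>). \<forall>m\<in>{1..i}. ordered_value s q m \<le> a m} = \<gamma>"
proof -
  let ?q = "least_favourable_pvalues s n \<gamma>"
  have "(\<forall>m\<in>{1..i}. ordered_value s (?q u) m \<le> a m) \<longleftrightarrow> u \<le> \<gamma>" if "u \<in> {0<..<1}" for u
  proof
    assume "\<forall>m\<in>{1..i}. ordered_value s (?q u) m \<le> a m"
    then have "ordered_value s (?q u) i \<le> a i" using assms by auto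
    then show "u \<le> \<gamma>"
      using least_favourable_ordered_value_gt [of n s i \<gamma> u "a i"] assms by force
  next
    assume "u \<le> \<gamma>"
    then show "\<forall>m\<in>{1..i}. ordered_value s (?q u) m \<le> a m"
      using that assms by (auto intro!: least_favourable_ordered_value_le)
  qed
  then have "{u \<in> {0<..<1}. \<forall>m\<in>{1..i}. ordered_value s (?q u) m \<le> a m} = {u \<in> {0<..<1}. u \<le> \<gamma>}"
    by blast
  moreover have "i \<le> s" using assms by simp
  ultimately show ?thesis
    by (simp only: measure_least_favourable [OF assms(1,2) measurable_ordered_values_le]
        measure_unit_lebesgue_le [OF assms(1,2)])
qed

section \<open>The stepdown constants\<close>

lemma stepdown_const_at:
  assumes "k \<le> i" "i \<le> s"
  shows "stepdown_const s k \<alpha> i = real k * \<alpha> / real (s + k - i)"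
  using assms by (auto simp: stepdown_const_def)

text \<open>
  Where the truncated difference \<open>m + k - i\<close> is \<open>0\<close>, this is positivity of the constant.
  Otherwise, with \<open>l = m + k - i\<close> and \<open>n = s + k - i\<close>, the constant at \<open>m\<close> is at least
  \<open>k\<alpha>/(n + k - l)\<close>, also when \<open>m \<le> k\<close>, because then \<open>s \<le> s + k - m\<close>. What remains is
  \<open>(k - l)(n - l) > 0\<close>. The strictness leaves the room that is needed to raise the level above
  \<open>\<alpha>\<close>.
\<close>

lemma stepdown_const_gt:
  assumes "1 \<le> k" "k \<le> i" "i \<le> s" "m < i" "1 \<le> m" "0 < \<alpha>"
  shows "real (m + k - i) * \<alpha> / real (s + k - i) < stepdown_const s k \<alpha> m"
proof (cases "m + k \<le> i")
  case True
  then show ?thesis using assms by (auto simp: stepdown_const_def intro!: divide_pos_pos mult_pos_pos)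
next
  case False
  define l n where "l = m + k - i" and "n = s + k - i"
  have l: "l < k" "k \<le> n" using assms False by (auto simp: l_def n_def)
  have m: "real s + real k - real m = real n + real k - real l"
    using assms False by (simp add: l_def n_def)
  have "0 < (real k - real l) * (real n - real l)"
    using l by (intro mult_pos_pos) auto
  then have "real l * (real n + real k - real l) < real k * real n"
    by (simp add: algebra_simps)
  then have "\<alpha> * (real l * (real n + real k - real l)) < \<alpha> * (real k * real n)"
    using assms by simp
  then have "real l * \<alpha> / real n < real k * \<alpha> / (real n + real k - real l)"
    using l assms by (simp add: divide_less_eq less_divide_eq algebra_simps)
  also have "\<dots> \<le> stepdown_const s k \<alpha> m"
    using assms by (auto simp: stepdown_const_def m [symmetric] intro!: divide_left_mono mult_pos_pos)
  finally show ?thesis by (simp add: l_def n_def)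
qed

section \<open>Sharpness of the constants\<close>

theorem theorem2p3:
  fixes s k :: nat and \<alpha> :: real
  assumes "1 \<le> s" and "1 \<le> k" and "k \<le> s" and "0 < \<alpha>" and "\<alpha> < 1"
  shows
    "(\<forall>i\<in>{k..s}. \<exists>\<mu> :: (nat \<Rightarrow> real) measure.
        prob_space \<mu> \<and>
        sets \<mu> = sets (Pi\<^sub>M {1..s} (\<lambda>_. restrict_space borel {0..1})) \<and>
        (\<exists>J \<subseteq> {1..s}. card J = s + k - i \<and>
           (\<forall>j\<in>J. distr \<mu> borel (\<lambda>q. q j) = uniform_measure lborel {0<..<1})) \<and>
        measure \<mu> {q \<in> space \<mu>.
          \<forall>m\<in>{1..i}. ordered_value s q m \<le> stepdown_const s k \<alpha> m} = \<alpha>)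
     \<and>
     (\<forall>i\<in>{k..s}. \<forall>c > stepdown_const s k \<alpha> i.
        \<exists>(N :: (nat \<Rightarrow> real) measure) \<Omega> \<omega> p.
          testing_model s N \<Omega> \<omega> \<and> p_values s N p \<and> valid_p_values s \<omega> p \<and>
          (\<exists>P\<in>\<Omega>. \<forall>\<sigma>. tie_ordering s N p \<sigma> \<longrightarrow>
             kFWER s k ((stepdown_const s k \<alpha>)(i := c)) \<omega> p \<sigma> P > \<alpha>))"
proof (intro conjI ballI allI impI)
  fix i assume i: "i \<in> {k..s}"
  define n where "n = s + k - i"
  have n: "0 < n" "n \<le> s" "k \<le> n" "s < i + n" and mn: "m + n - s = m + k - i" for m
    using i assms by (auto simp: n_def)
  let ?\<mu> = "least_favourable s n \<alpha>"
  have at_i: "stepdown_const s k \<alpha> i = real k * \<alpha> / real n"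
    using i by (simp add: stepdown_const_at n_def)
  have le: "real (m + n - s) * \<alpha> / real n \<le> stepdown_const s k \<alpha> m" if "m \<in> {1..i}" for m
  proof (cases "m = i")
    case True
    then show ?thesis by (simp add: mn at_i)
  next
    case False
    then show ?thesis
      using stepdown_const_gt [of k i s m \<alpha>] that i assms unfolding mn n_def by auto
  qed
  have "stepdown_const s k \<alpha> i \<le> \<alpha>"
    using n assms by (simp add: at_i divide_le_eq mult.commute)
  then have "measure ?\<mu> {q \<in> space ?\<mu>.
      \<forall>m\<in>{1..i}. ordered_value s q m \<le> stepdown_const s k \<alpha> m} = \<alpha>"
    using i assms n le by (intro least_favourable_prob_eq) auto
  moreover have "\<exists>J\<subseteq>{1..s}. card J = s + k - i \<and>
      (\<forall>j\<in>J. distr ?\<mu> borel (\<lambda>q. q j) = uniform_measure lborel {0<..<1})"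
    using n assms by (intro exI [of _ "{1..n}"]) (auto simp: n_def intro!: least_favourable_marginal)
  ultimately show "\<exists>\<mu> :: (nat \<Rightarrow> real) measure. prob_space \<mu> \<and>
      sets \<mu> = sets (Pi\<^sub>M {1..s} (\<lambda>_. restrict_space borel {0..1})) \<and>
      (\<exists>J \<subseteq> {1..s}. card J = s + k - i \<and>
         (\<forall>j\<in>J. distr \<mu> borel (\<lambda>q. q j) = uniform_measure lborel {0<..<1})) \<and>
      measure \<mu> {q \<in> space \<mu>.
        \<forall>m\<in>{1..i}. ordered_value s q m \<le> stepdown_const s k \<alpha> m} = \<alpha>"
    using assms by (intro exI [of _ ?\<mu>] conjI prob_space_least_favourable sets_least_favourable)
next
  fix i c assume i: "i \<in> {k..s}" and c: "stepdown_const s k \<alpha> i < c"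
  define n where "n = s + k - i"
  have n: "0 < n" "n \<le> s" "k \<le> n" "n + i = s + k" and mn: "m + n - s = m + k - i" for m
    using i assms by (auto simp: n_def)
  let ?a = "(stepdown_const s k \<alpha>)(i := c)"
  have at_i: "stepdown_const s k \<alpha> i = real k * \<alpha> / real n"
    using i by (simp add: stepdown_const_at n_def)
  have less: "real (m + n - s) * \<alpha> / real n < ?a m" if "m \<in> {1..i}" for m
  proof (cases "m = i")
    case True
    then show ?thesis using c by (simp add: mn at_i)
  next
    case False
    then show ?thesis
      using stepdown_const_gt [of k i s m \<alpha>] that i assms unfolding mn n_def by auto
  qed
  \<comment> \<open>Finitely many strict inequalities at \<open>\<alpha>\<close> persist slightly to its right.\<close>
  have "eventually (\<lambda>\<gamma>. real (m + n - s) * \<gamma> / real n < ?a m) (at_right \<alpha>)"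
    if "m \<in> {1..i}" for m
    using n by (intro order_tendstoD(2) [OF _ less [OF that]] tendsto_intros) auto
  then have "eventually (\<lambda>\<gamma>. \<forall>m\<in>{1..i}. real (m + n - s) * \<gamma> / real n < ?a m) (at_right \<alpha>)"
    by (intro eventually_ball_finite) auto
  moreover have "eventually (\<lambda>\<gamma>. \<gamma> < 1) (at_right \<alpha>)"
    using assms by (intro order_tendstoD(2) [OF tendsto_ident_at])
  moreover have "eventually (\<lambda>\<gamma>. \<alpha> < \<gamma>) (at_right \<alpha>)"
    by (rule eventually_at_right_less)
  ultimately have "eventually (\<lambda>\<gamma>. \<alpha> < \<gamma> \<and> \<gamma> < 1 \<and>
      (\<forall>m\<in>{1..i}. real (m + n - s) * \<gamma> / real n < ?a m)) (at_right \<alpha>)"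
    by eventually_elim blast
  then obtain \<gamma> where \<gamma>: "\<alpha> < \<gamma>" "\<gamma> < 1"
      and \<gamma>_less: "\<And>m. m \<in> {1..i} \<Longrightarrow> real (m + n - s) * \<gamma> / real n < ?a m"
    using eventually_happens' [OF trivial_limit_at_right_real] by blast
  have pos: "0 < \<gamma>" using \<gamma> assms by simp
  let ?\<mu> = "least_favourable s n \<gamma>"
  \<comment> \<open>The only distribution satisfies exactly the hypotheses with uniform p-values.\<close>
  define \<omega> where "\<omega> j = (if j \<in> {1..n} then {?\<mu>} else {})" for j
  let ?p = "\<lambda>j (q :: nat \<Rightarrow> real). q j"
  have nulls: "true_nulls s \<omega> ?\<mu> = {1..n}"
    using n by (auto simp: true_nulls_def \<omega>_def split: if_splits)
  have space_\<mu>: "space ?\<mu> = space (unit_cube s)"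
    by (simp add: least_favourable_def)
  interpret prob_space ?\<mu>
    by (rule prob_space_least_favourable [OF pos \<gamma>(2)])
  have model: "testing_model s (unit_cube s) {?\<mu>} \<omega>"
    by (auto simp: testing_model_def \<omega>_def sets_least_favourable intro: prob_space_axioms)
  have pvals: "p_values s (unit_cube s) ?p"
    by (auto simp: p_values_def space_PiM space_restrict_space PiE_iff
        simp del: One_nat_def intro!: measurable_coordinate)
  have "measure ?\<mu> {x \<in> space ?\<mu>. x j \<le> u} = u" if j: "j \<in> {1..n}" and u: "u \<in> {0<..<1}" for j u
  proof -
    have meas: "(\<lambda>q. q j) \<in> borel_measurable ?\<mu>"
      using measurable_coordinate [of j s] j n
      by (simp add: measurable_cong_sets [OF sets_least_favourable refl])
    have "measure ?\<mu> {x \<in> space ?\<mu>. x j \<le> u} = measure (distr ?\<mu> borel (\<lambda>q. q j)) {..u}"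
      by (subst measure_distr [OF meas]) (auto intro!: arg_cong [where f = "measure _"])
    also have "\<dots> = measure (uniform_measure lborel {0<..<1}) {..u}"
      using least_favourable_marginal [OF pos \<gamma>(2) n(2) j] by simp
    also have "\<dots> = measure lborel ({0<..<1} \<inter> {..u})"
      by simp
    also have "{0<..<1} \<inter> {..u} = {0<..u}" using u by auto
    also have "measure lborel \<dots> = u" using u by simp
    finally show ?thesis .
  qed
  then have valid: "valid_p_values s \<omega> ?p"
    by (auto simp: valid_p_values_def \<omega>_def split: if_splits)
  have "\<alpha> < kFWER s k ?a \<omega> ?p \<sigma> ?\<mu>" if \<sigma>: "tie_ordering s (unit_cube s) ?p \<sigma>" for \<sigma>
  proof -
    have "\<gamma> \<le> measure ?\<mu> {q \<in> space ?\<mu>. \<forall>m\<in>{1..i}. ordered_value s q m \<le> ?a m}"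
      using i n pos \<gamma>(2) less_imp_le [OF \<gamma>_less] by (intro least_favourable_prob_ge) auto
    also have "\<dots> \<le> kFWER s k ?a \<omega> ?p \<sigma> ?\<mu>"
      unfolding kFWER_def nulls
    proof (rule finite_measure_mono)
      show "{q \<in> space ?\<mu>. \<forall>m\<in>{1..i}. ordered_value s q m \<le> ?a m}
          \<subseteq> {x \<in> space ?\<mu>. k \<le> card (stepdown_rejected s ?a (\<lambda>j. x j) (\<sigma> x) \<inter> {1..n})}"
      proof safe
        fix q assume "q \<in> space ?\<mu>" and le: "\<forall>m\<in>{1..i}. ordered_value s q m \<le> ?a m"
        then have "hypothesis_ordering s q (\<sigma> q)"
          using \<sigma> by (simp add: tie_ordering_def space_\<mu>)
        then show "k \<le> card (stepdown_rejected s ?a (\<lambda>j. q j) (\<sigma> q) \<inter> {1..n})"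
          using i n le by (intro stepdown_rejects_true_nulls) auto
      qed
      show "{x \<in> space ?\<mu>. k \<le> card (stepdown_rejected s ?a (\<lambda>j. x j) (\<sigma> x) \<inter> {1..n})}
          \<in> sets ?\<mu>"
        using predE [OF measurable_rejects_at_least [OF \<sigma>]]
        by (simp add: space_\<mu> sets_least_favourable)
    qed
    finally show ?thesis using \<gamma>(1) by simp
  qed
  with model pvals valid show "\<exists>(N :: (nat \<Rightarrow> real) measure) \<Omega> \<omega> p.
      testing_model s N \<Omega> \<omega> \<and> p_values s N p \<and> valid_p_values s \<omega> p \<and>
      (\<exists>P\<in>\<Omega>. \<forall>\<sigma>. tie_ordering s N p \<sigma> \<longrightarrow>
         kFWER s k ((stepdown_const s k \<alpha>)(i := c)) \<omega> p \<sigma> P > \<alpha>)"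
    by blast
qed

end
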